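(* Let $\mathbf{R}$ and $\mathbf{S}$ be square transfer matrices of the same size such that $\mathbf{R}$ is the realization matrix and $\mathbf{S}$ is the internal stability matrix of the same closed-loop linear system; that is, for every external disturbance $\mathbf{d}$, the internal state $\boldsymbol{\eta}$ produced by $\mathbf{d}$ satisfies both $\boldsymbol{\eta} = \mathbf{R}\boldsymbol{\eta} + \mathbf{d}$ and $\boldsymbol{\eta} = \mathbf{S}\mathbf{d}$. Then $$(I-\mathbf{R})\,\mathbf{S} = \mathbf{S}\,(I-\mathbf{R}) = I .$$
   Context: A closed-loop linear system has an internal state vector $\boldsymbol{\eta}$ collecting all signals in the system, and an external disturbance vector $\mathbf{d}$ of the same dimension as $\boldsymbol{\eta}$ (every component of $\boldsymbol{\eta}$ has its own corresponding disturbance component). Signals are represented in the transform domain. Transfer matrices are matrices of rational functions in the transform variable, acting on signals by multiplication; no causality (properness) or stability is assumed. The disturbance $\mathbf{d}$ is arbitrary. The realization matrix $\mathbf{R}$ is the square transfer matrix through which the system operates according to $\boldsymbol{\eta} = \mathbf{R}\boldsymbol{\eta} + \mathbf{d}$. The internal stability matrix $\mathbf{S}$ is the transfer matrix from $\mathbf{d}$ to $\boldsymbol{\eta}$, i.e. $\boldsymbol{\eta} = \mathbf{S}\mathbf{d}$. $I$ is the identity matrix. *)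

theory Defs
  imports
    "HOL-Analysis.Cartesian_Space"
    "HOL-Computational_Algebra.Polynomial"
    "HOL-Computational_Algebra.Fraction_Field"
begin

text \<open>
  Rational functions in the transform variable, with coefficients in a field such as the
  reals or the complex numbers. All rational functions are admitted: neither properness nor
  stability is required.
\<close>

type_synonym 'k transfer_function = "'k poly fract"

type_synonym ('k, 'n) transfer_matrix = "'k transfer_function ^ 'n ^ 'n"

text \<open>
  Transform-domain scalar signals need not be rational. All that is used is that they can be
  added and multiplied by rational functions, and that some nonzero signal exists.
\<close>

locale signal_space = vector_space act
  for act :: "'k::field transfer_function \<Rightarrow> 's::ab_group_add \<Rightarrow> 's" +
  assumes nonzero_signal: "\<exists>v::'s. v \<noteq> 0"

definition apply_transfer ::
    "('k::field transfer_function \<Rightarrow> 's::ab_group_add \<Rightarrow> 's) \<Rightarrow>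
     ('k, 'n::finite) transfer_matrix \<Rightarrow> 's ^ 'n \<Rightarrow> 's ^ 'n" where
  "apply_transfer act M x = (\<chi> i. \<Sum>j\<in>UNIV. act (M $ i $ j) (x $ j))"

text \<open>For rational signals this is the usual setting.\<close>

lemma signal_space_rational:
  "signal_space ((*) :: 'k::field transfer_function \<Rightarrow> 'k transfer_function \<Rightarrow> 'k transfer_function)"
proof unfold_locales
  show "\<exists>v::'k transfer_function. v \<noteq> 0"
    by (rule exI[of _ 1]) simp
qed

lemma apply_transfer_rational: "apply_transfer (*) M x = M *v x"
  by (simp add: apply_transfer_def matrix_vector_mult_def)

text \<open>
  A system is given by the map \<open>state\<close> sending each external disturbance to the internal
  state it produces.
\<close>

definition realization_matrix ::
    "('k::field transfer_function \<Rightarrow> 's::ab_group_add \<Rightarrow> 's) \<Rightarrow>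
     ('s ^ 'n \<Rightarrow> 's ^ 'n) \<Rightarrow> ('k, 'n::finite) transfer_matrix \<Rightarrow> bool" where
  "realization_matrix act state R \<longleftrightarrow>
     (\<forall>d. state d = apply_transfer act R (state d) + d)"

definition internal_stability_matrix ::
    "('k::field transfer_function \<Rightarrow> 's::ab_group_add \<Rightarrow> 's) \<Rightarrow>
     ('s ^ 'n \<Rightarrow> 's ^ 'n) \<Rightarrow> ('k, 'n::finite) transfer_matrix \<Rightarrow> bool" where
  "internal_stability_matrix act state S \<longleftrightarrow>
     (\<forall>d. state d = apply_transfer act S d)"

end

theory Submission
  imports Defs
begin

text \<open>Eliminating the state from its two descriptions gives S d = R (S d) + d, so S and R S +
  I act alike on every disturbance d. Because d is arbitrary, the action determines the matrix
  (\<open>apply_transfer_eqD\<close>), hence S = R S + I, that is, (I - R) S = I. The matrices are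
  square over the field of rational functions, so this right inverse of I - R is also a left
  inverse.\<close>

lemma matrix_diff_rdistrib:
  fixes A B :: "'a::ring_1 ^ 'n ^ 'm"
  shows "(A - B) ** C = A ** C - B ** C"
  by (simp add: matrix_matrix_mult_def vec_eq_iff left_diff_distrib sum_subtractf)

context signal_space
begin

lemma apply_transfer_matrix_mul:
  "apply_transfer act (A ** B) x = apply_transfer act A (apply_transfer act B x)"
proof -
  have "(\<Sum>j\<in>UNIV. act (\<Sum>k\<in>UNIV. A $ i $ k * B $ k $ j) (x $ j)) =
      (\<Sum>k\<in>UNIV. act (A $ i $ k) (\<Sum>j\<in>UNIV. act (B $ k $ j) (x $ j)))" for i
    by (simp add: scale_sum_left scale_sum_right) (rule sum.swap)
  then show ?thesis
    by (simp add: apply_transfer_def matrix_matrix_mult_def vec_eq_iff)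
qed

lemma apply_transfer_add_left:
  "apply_transfer act (A + B) x = apply_transfer act A x + apply_transfer act B x"
  by (simp add: apply_transfer_def vec_eq_iff scale_left_distrib sum.distrib)

lemma apply_transfer_axis:
  "apply_transfer act M (axis j v) $ i = act (M $ i $ j) v"
proof -
  have "act (M $ i $ k) (axis j v $ k) = (if k = j then act (M $ i $ j) v else 0)" for k
    by (simp add: axis_def)
  then show ?thesis
    by (simp add: apply_transfer_def)
qed

lemma apply_transfer_mat_1: "apply_transfer act (mat 1) x = x"
proof -
  have "act (mat 1 $ i $ j) (x $ j) = (if j = i then x $ i else 0)" for i j
    by (simp add: mat_def)
  then show ?thesis
    by (simp add: apply_transfer_def vec_eq_iff)
qed

text \<open>A nonzero signal \<open>v\<close> fed into coordinate \<open>j\<close> alone exposes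
  column \<open>j\<close>: output \<open>i\<close> is the entry at \<open>i\<close>,
  \<open>j\<close> acting on \<open>v\<close>. Scalars come from a field, so \<open>v\<close> can be
  cancelled.\<close>

lemma apply_transfer_eqD:
  assumes "\<And>x. apply_transfer act A x = apply_transfer act B x"
  shows "A = B"
proof -
  obtain v :: 's where v: "v \<noteq> 0"
    using nonzero_signal by blast
  have "act (A $ i $ j) v = act (B $ i $ j) v" for i j
    using assms[of "axis j v"] by (metis apply_transfer_axis)
  with v show ?thesis
    by (simp add: vec_eq_iff)
qed

end

theorem lemma1:
  fixes act :: "'k::field transfer_function \<Rightarrow> 's::ab_group_add \<Rightarrow> 's"
    and state :: "'s ^ 'n::finite \<Rightarrow> 's ^ 'n"
    and R S :: "('k, 'n) transfer_matrix"
  assumes "signal_space act"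
    and "realization_matrix act state R"
    and "internal_stability_matrix act state S"
  shows "(mat 1 - R) ** S = mat 1 \<and> S ** (mat 1 - R) = mat 1"
proof -
  interpret signal_space act by fact
  \<comment> \<open>Both sides equal \<open>state d\<close>: the left by internal stability, the
    right by putting S d for the state in the realization equation.\<close>
  have "apply_transfer act S d = apply_transfer act (R ** S + mat 1) d" for d
    using assms(2,3)
    by (simp add: realization_matrix_def internal_stability_matrix_def
        apply_transfer_add_left apply_transfer_matrix_mul apply_transfer_mat_1)
  then have "S = R ** S + mat 1"
    by (rule apply_transfer_eqD)
  then have "(mat 1 - R) ** S = mat 1"
    by (metis add_diff_cancel_left' matrix_mul_lid matrix_diff_rdistrib)
  \<comment> \<open>Commutation comes from finite dimension over a field, not from a second
    computation with signals.\<close>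
  then show ?thesis
    by (simp add: matrix_left_right_inverse)
qed

end
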